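(* Let $\Omega$ be the quasi-periodic channel of the context, with continuous $f_\pm$ and the uniform separation condition. The Robin hull function $\mathscr R:\mathcal D\to\mathbb R$, $\mathscr R(\theta,y)=R_{\Omega_\theta}(0,y)$, is periodic with respect to each component of $\theta$. Moreover, for every $\theta\in\mathbb T^d$ and every $(x,y)\in\Omega_\theta$, $$R_{\Omega_\theta}(x,y)=\mathscr R(\theta+x\omega,y).$$ In particular $R_\Omega(x,y)=\mathscr R(x\omega,y)$ for all $(x,y)\in\Omega$. Consequently, along every horizontal line contained in the channel, the map $x\mapsto R_\Omega(x,y)$ is quasi-periodic with frequency vector $\omega$.
   Context: $\mathbb T^d=\mathbb R^d/(2\pi\mathbb Z)^d$; vectors in $\mathbb R^d$ are read modulo $2\pi$ as torus points. Channel: $d=d_-+d_+$, $\omega=(\omega_-,\omega_+)\in\mathbb R^{d_-}\times\mathbb R^{d_+}$ nonresonant ($\omega\cdot\ell\ne0$ for all $\ell\in\mathbb Z^d\setminus\{0\}$); $f_\pm:\mathbb T^{d_\pm}\to\mathbb R$ continuous; $\Omega=\{(x,y)\in\mathbb R^2:f_-(\omega_-x)<y<f_+(\omega_+x)\}$, with $\inf_{x\in\mathbb R}f_+(\omega_+x)-\sup_{x\in\mathbb R}f_-(\omega_-x)=h_0>0$. Robin function: for a planar channel domain $D$, $G_D$ is the (classical, minimal positive) Dirichlet Green function, $-\Delta_zG_D(z,\zeta)=\delta_\zeta(z)$, $G_D(z,\zeta)=0$ for $z\in\partial D$, and $R_D(z)=\lim_{\zeta\to z}\big(G_D(z,\zeta)+\frac1{2\pi}\log|z-\zeta|\big)$.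 Hull: for $\theta=(\theta_-,\theta_+)$, $\Omega_\theta=\{(x,y): f_-(\omega_-x+\theta_-)<y<f_+(\omega_+x+\theta_+)\}$, and $\mathcal D=\{(\theta,y)\in\mathbb T^d\times\mathbb R: f_-(\theta_-)<y<f_+(\theta_+)\}$. "Quasi-periodic with frequency vector $\omega$" means of the form $x\mapsto F(x\omega)$ for a function $F$ on $\mathbb T^d$. *)

theory Defs
  imports "HOL-Analysis.Analysis"
begin

subsection \<open>Functions on the torus and quasi-periodicity\<close>

text \<open>For a product of Euclidean spaces the standard basis is the union of the bases of the
  factors, so \<open>int_lattice\<close> on \<open>(real ^ 'm) \<times> (real ^ 'n)\<close> is the full integer lattice of rank
  \<open>CARD('m) + CARD('n)\<close>.\<close>

definition int_lattice :: "'a::euclidean_space set" where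
  "int_lattice = {l. \<forall>b\<in>Basis. l \<bullet> b \<in> \<int>}"

text \<open>Functions on $\mathbb{R}^d/(2\pi\mathbb{Z})^d$ are represented by their lifts to the
  universal cover, i.e. by functions invariant under the lattice; a lift is continuous iff the
  function on the torus is.\<close>

definition torus_periodic :: "('a::euclidean_space \<Rightarrow> 'b) \<Rightarrow> bool" where
  "torus_periodic F \<longleftrightarrow> (\<forall>x. \<forall>l\<in>int_lattice. F (x + (2 * pi) *\<^sub>R l) = F x)"

definition nonresonant :: "'a::euclidean_space \<Rightarrow> bool" where
  "nonresonant \<omega> \<longleftrightarrow> (\<forall>l\<in>int_lattice - {0}. \<omega> \<bullet> l \<noteq> 0)"

definition quasi_periodic :: "'a::euclidean_space \<Rightarrow> (real \<Rightarrow> 'b) \<Rightarrow> bool" where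
  "quasi_periodic \<omega> g \<longleftrightarrow> (\<exists>F. torus_periodic F \<and> g = (\<lambda>x. F (x *\<^sub>R \<omega>)))"

subsection \<open>Green function and Robin function of a planar domain\<close>

definition partial_x :: "(real \<times> real \<Rightarrow> real) \<Rightarrow> real \<times> real \<Rightarrow> real" where
  "partial_x f z = deriv (\<lambda>t. f (t, snd z)) (fst z)"

definition partial_y :: "(real \<times> real \<Rightarrow> real) \<Rightarrow> real \<times> real \<Rightarrow> real" where
  "partial_y f z = deriv (\<lambda>t. f (fst z, t)) (snd z)"

definition laplacian :: "(real \<times> real \<Rightarrow> real) \<Rightarrow> real \<times> real \<Rightarrow> real" where
  "laplacian f z = partial_x (partial_x f) z + partial_y (partial_y f) z"

primrec C_k :: "nat \<Rightarrow> (real \<times> real \<Rightarrow> real) \<Rightarrow> bool" where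
  "C_k 0 f \<longleftrightarrow> continuous_on UNIV f"
| "C_k (Suc k) f \<longleftrightarrow>
     (\<forall>z. f differentiable (at z)) \<and> C_k k (partial_x f) \<and> C_k k (partial_y f)"

definition test_function :: "(real \<times> real) set \<Rightarrow> (real \<times> real \<Rightarrow> real) \<Rightarrow> bool" where
  "test_function D \<phi> \<longleftrightarrow>
     (\<forall>k. C_k k \<phi>) \<and> compact (closure {z. \<phi> z \<noteq> 0}) \<and> closure {z. \<phi> z \<noteq> 0} \<subseteq> D"

text \<open>$-\Delta u = \delta_\zeta$ in the sense of distributions on \<open>D\<close>, for locally integrable \<open>u\<close>.\<close>

definition neg_laplace_eq_delta ::
    "(real \<times> real) set \<Rightarrow> real \<times> real \<Rightarrow> (real \<times> real \<Rightarrow> real) \<Rightarrow> bool" where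
  "neg_laplace_eq_delta D \<zeta> u \<longleftrightarrow>
     (\<forall>K. compact K \<and> K \<subseteq> D \<longrightarrow> set_integrable lborel K u) \<and>
     (\<forall>\<phi>. test_function D \<phi> \<longrightarrow> (LINT z:D|lborel. u z * (- laplacian \<phi> z)) = \<phi> \<zeta>)"

text \<open>The Dirichlet condition is the classical one: \<open>u\<close> is continuous up to the boundary, away
  from the pole, and vanishes there. On an unbounded domain this does not determine \<open>u\<close>: on a
  strip one may add positive harmonic functions that vanish on the boundary and grow at infinity.\<close>

definition positive_dirichlet_solution ::
    "(real \<times> real) set \<Rightarrow> real \<times> real \<Rightarrow> (real \<times> real \<Rightarrow> real) \<Rightarrow> bool" where
  "positive_dirichlet_solution D \<zeta> u \<longleftrightarrow>
     (\<forall>z\<in>D - {\<zeta>}. u z > 0) \<and>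
     neg_laplace_eq_delta D \<zeta> u \<and>
     continuous_on (closure D - {\<zeta>}) u \<and>
     (\<forall>z\<in>frontier D. u z = 0)"

definition minimal_dirichlet_solution ::
    "(real \<times> real) set \<Rightarrow> real \<times> real \<Rightarrow> (real \<times> real \<Rightarrow> real) \<Rightarrow> bool" where
  "minimal_dirichlet_solution D \<zeta> u \<longleftrightarrow>
     positive_dirichlet_solution D \<zeta> u \<and>
     (\<forall>v. positive_dirichlet_solution D \<zeta> v \<longrightarrow> (\<forall>z\<in>D - {\<zeta>}. u z \<le> v z))"

text \<open>The minimal solution is unique on \<open>closure D - {\<zeta>}\<close> only (its values elsewhere are
  unconstrained), so the definite description ranges over its value at \<open>z\<close>. The second argument
  \<open>\<zeta>\<close> is the pole.\<close>

definition green :: "(real \<times> real) set \<Rightarrow> real \<times> real \<Rightarrow> real \<times> real \<Rightarrow> real" where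
  "green D z \<zeta> = (THE g. \<exists>u. minimal_dirichlet_solution D \<zeta> u \<and> g = u z)"

definition robin :: "(real \<times> real) set \<Rightarrow> real \<times> real \<Rightarrow> real" where
  "robin D z = Lim (at z) (\<lambda>\<zeta>. green D z \<zeta> + 1 / (2 * pi) * ln (norm (z - \<zeta>)))"

subsection \<open>The channel and its hull\<close>

definition channel ::
    "(real ^ 'm \<Rightarrow> real) \<Rightarrow> (real ^ 'n \<Rightarrow> real) \<Rightarrow> (real ^ 'm) \<times> (real ^ 'n) \<Rightarrow> (real \<times> real) set" where
  "channel fm fp \<omega> = {(x, y). fm (x *\<^sub>R fst \<omega>) < y \<and> y < fp (x *\<^sub>R snd \<omega>)}"

definition hull_channel ::
    "(real ^ 'm \<Rightarrow> real) \<Rightarrow> (real ^ 'n \<Rightarrow> real) \<Rightarrow> (real ^ 'm) \<times> (real ^ 'n) \<Rightarrow>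
     (real ^ 'm) \<times> (real ^ 'n) \<Rightarrow> (real \<times> real) set" where
  "hull_channel fm fp \<omega> \<theta> =
     {(x, y). fm (x *\<^sub>R fst \<omega> + fst \<theta>) < y \<and> y < fp (x *\<^sub>R snd \<omega> + snd \<theta>)}"

text \<open>The preimage of the set $\mathcal{D} \subseteq \mathbb{T}^d \times \mathbb{R}$ in the
  universal cover.\<close>

definition hull_domain ::
    "(real ^ 'm \<Rightarrow> real) \<Rightarrow> (real ^ 'n \<Rightarrow> real) \<Rightarrow> (((real ^ 'm) \<times> (real ^ 'n)) \<times> real) set" where
  "hull_domain fm fp = {(\<theta>, y). fm (fst \<theta>) < y \<and> y < fp (snd \<theta>)}"

definition robin_hull ::
    "(real ^ 'm \<Rightarrow> real) \<Rightarrow> (real ^ 'n \<Rightarrow> real) \<Rightarrow> (real ^ 'm) \<times> (real ^ 'n) \<Rightarrow>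
     (real ^ 'm) \<times> (real ^ 'n) \<Rightarrow> real \<Rightarrow> real" where
  "robin_hull fm fp \<omega> \<theta> y = robin (hull_channel fm fp \<omega> \<theta>) (0, y)"

end

theory Submission
  imports Defs
begin

text \<open>The hull channel at \<open>\<theta> + x\<omega>\<close> is the horizontal translate by \<open>-x\<close> of the hull channel at \<open>\<theta>\<close>,
  and every notion entering the definition of the Robin function (test functions, distributional
  solutions, minimality, limits) is invariant under translations of the plane. Periodicity holds
  because lattice translates of \<open>\<theta>\<close> define the same hull channel. The definite descriptions defining
  \<open>green\<close> and \<open>robin\<close> are transported as they stand, so existence of the Green function and of the
  limit plays no role.\<close>

section \<open>Derivatives and test functions under translation\<close>

lemma deriv_shift:
  fixes f :: "'a::real_normed_field \<Rightarrow> 'a"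
  shows "deriv (\<lambda>t. f (t - a)) x = deriv f (x - a)"
  \<comment> \<open>\<open>DERIV_shift\<close> is an equivalence, so both sides of the claim choose
    from the same derivative candidates, and equality persists where no derivative exists.\<close>
  using DERIV_shift[of f _ x "- a"] by (simp add: deriv_def)

text \<open>Stated between functions, so that it also rewrites the inner derivative of the second
  derivatives in \<open>laplacian\<close>.\<close>

lemma partial_x_translation: "partial_x (\<lambda>z. f (z - c)) = (\<lambda>z. partial_x f (z - c))"
proof
  fix z
  have "(\<lambda>t. f ((t, snd z) - c)) = (\<lambda>t. f (t - fst c, snd (z - c)))"
    by (cases c) simp
  then show "partial_x (\<lambda>z. f (z - c)) z = partial_x f (z - c)"
    using deriv_shift[of "\<lambda>t. f (t, snd (z - c))" "fst c" "fst z"]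
    by (simp add: partial_x_def)
qed

lemma partial_y_translation: "partial_y (\<lambda>z. f (z - c)) = (\<lambda>z. partial_y f (z - c))"
proof
  fix z
  have "(\<lambda>t. f ((fst z, t) - c)) = (\<lambda>t. f (fst (z - c), t - snd c))"
    by (cases c) simp
  then show "partial_y (\<lambda>z. f (z - c)) z = partial_y f (z - c)"
    using deriv_shift[of "\<lambda>t. f (fst (z - c), t)" "snd c" "snd z"]
    by (simp add: partial_y_def)
qed

lemma laplacian_translation: "laplacian (\<lambda>z. f (z - c)) z = laplacian f (z - c)"
  by (simp add: laplacian_def partial_x_translation partial_y_translation)

lemma C_k_translation: "C_k k f \<Longrightarrow> C_k k (\<lambda>z. f (z - c))"
\<comment> \<open>\<open>f\<close> must vary: the induction hypothesis is applied to its two partial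
  derivatives.\<close>
proof (induction k arbitrary: f)
  case 0
  then show ?case
    by (auto intro!: continuous_on_compose2[of UNIV f] continuous_intros)
next
  case (Suc k)
  have "(\<lambda>z. f (z - c)) differentiable (at z)" for z
    using Suc.prems differentiable_chain_at[of "\<lambda>z. z - c" z f]
    by (simp add: o_def del: split_paired_All)
  then show ?case
    using Suc by (simp add: partial_x_translation partial_y_translation)
qed

lemma mem_translation_iff: "z \<in> (+) c ` D \<longleftrightarrow> z - c \<in> (D :: 'a::ab_group_add set)"
  by (auto simp: image_iff algebra_simps intro!: bexI[of _ "z - c"])

lemma Collect_translation: "{z. P (z - c)} = (+) c ` {z::'a::ab_group_add. P z}"
  by (rule set_eqI, unfold mem_translation_iff) simp

lemma test_function_translation:
  assumes "test_function D \<phi>"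
  shows "test_function ((+) c ` D) (\<lambda>z. \<phi> (z - c))"
proof -
  have "closure {z. \<phi> (z - c) \<noteq> 0} = (+) c ` closure {z. \<phi> z \<noteq> 0}"
    unfolding Collect_translation[of "\<lambda>z. \<phi> z \<noteq> 0"] by (rule closure_translation)
  with assms show ?thesis
    by (auto simp: test_function_def C_k_translation compact_translation)
qed

section \<open>Lebesgue integrals under translation\<close>

lemma integrable_lborel_translation:
  fixes f :: "'a::euclidean_space \<Rightarrow> 'b::{banach, second_countable_topology}"
  shows "integrable lborel (\<lambda>z. f (z - c)) \<longleftrightarrow> integrable lborel f"
proof -
  \<comment> \<open>Translation invariance of \<open>lborel\<close> gives one direction for every
    shift; the converse is the same fact for the opposite shift.\<close>
  have shift: "integrable lborel (\<lambda>z. g (a + z))" if "integrable lborel g"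
    for g :: "'a \<Rightarrow> 'b" and a
    using integrable_distr[of "(+) a" lborel borel g] that by (simp add: lborel_distr_plus)
  from shift[of f "- c"] shift[of "\<lambda>z. f (z - c)" c] show ?thesis
    by auto
qed

lemma integral_lborel_translation:
  fixes f :: "'a::euclidean_space \<Rightarrow> 'b::{banach, second_countable_topology}"
  shows "(LINT z|lborel. f (z - c)) = (LINT z|lborel. f z)"
\<comment> \<open>Integrability supplies the measurability that the change of variables needs;
  without it both integrals have the default value 0.\<close>
proof (cases "integrable lborel f")
  case True
  then show ?thesis
    using integral_distr[of "(+) (- c)" lborel borel f] by (simp add: lborel_distr_plus)
next
  case False
  then show ?thesis
    by (simp add: integrable_lborel_translation not_integrable_integral_eq)
qed

lemma indicator_translation:
  "indicator ((+) c ` A) z = indicator A (z - c :: 'a::ab_group_add)"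
  by (simp add: indicator_def mem_translation_iff)

lemma set_integrable_lborel_translation:
  fixes u :: "'a::euclidean_space \<Rightarrow> 'b::{banach, second_countable_topology}"
  shows "set_integrable lborel ((+) c ` A) (\<lambda>z. u (z - c)) \<longleftrightarrow> set_integrable lborel A u"
  unfolding set_integrable_def indicator_translation
  by (rule integrable_lborel_translation[of "\<lambda>z. indicator A z *\<^sub>R u z"])

lemma set_integral_lborel_translation:
  fixes u :: "'a::euclidean_space \<Rightarrow> 'b::{banach, second_countable_topology}"
  shows "(LINT z:(+) c ` A|lborel. u (z - c)) = (LINT z:A|lborel. u z)"
  unfolding set_lebesgue_integral_def indicator_translation
  by (rule integral_lborel_translation[of "\<lambda>z. indicator A z *\<^sub>R u z"])

section \<open>Dirichlet solutions, Green function and Robin function under translation\<close>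

lemma neg_laplace_eq_delta_translation:
  assumes "neg_laplace_eq_delta D \<zeta> u"
  shows "neg_laplace_eq_delta ((+) c ` D) (c + \<zeta>) (\<lambda>z. u (z - c))"
  unfolding neg_laplace_eq_delta_def
proof (intro conjI allI impI)
  fix K assume K: "compact K \<and> K \<subseteq> (+) c ` D"
  then have "compact ((+) (- c) ` K)" "(+) (- c) ` K \<subseteq> D"
    using compact_translation[of K "- c"] by auto
  with assms have "set_integrable lborel ((+) (- c) ` K) u"
    by (simp add: neg_laplace_eq_delta_def)
  then have "set_integrable lborel ((+) c ` (+) (- c) ` K) (\<lambda>z. u (z - c))"
    by (simp only: set_integrable_lborel_translation)
  then show "set_integrable lborel K (\<lambda>z. u (z - c))"
    by (simp add: image_image)
next
  fix \<phi> assume "test_function ((+) c ` D) \<phi>"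
  \<comment> \<open>The test function is pulled back to \<open>D\<close>, where the equation for
    \<open>u\<close> applies; the resulting integral is then shifted forward by
    \<open>c\<close>.\<close>
  from test_function_translation[OF this, of "- c"]
  have "test_function D (\<lambda>z. \<phi> (z - (- c)))"
    by (simp add: image_image)
  with assms have "(LINT z:D|lborel. u z * (- laplacian (\<lambda>z. \<phi> (z - (- c))) z)) = \<phi> (\<zeta> - (- c))"
    unfolding neg_laplace_eq_delta_def by blast
  then show "(LINT z:(+) c ` D|lborel. u (z - c) * (- laplacian \<phi> z)) = \<phi> (c + \<zeta>)"
    unfolding laplacian_translation
    using set_integral_lborel_translation[of c D "\<lambda>z. u z * (- laplacian \<phi> (z + c))"]
    by (simp add: add.commute)
qed

lemma positive_dirichlet_solution_translation:
  assumes "positive_dirichlet_solution D \<zeta> u"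
  shows "positive_dirichlet_solution ((+) c ` D) (c + \<zeta>) (\<lambda>z. u (z - c))"
proof -
  have "continuous_on (closure D - {\<zeta>}) u"
    using assms by (simp add: positive_dirichlet_solution_def)
  then have "continuous_on (closure ((+) c ` D) - {c + \<zeta>}) (\<lambda>z. u (z - c))"
    by (rule continuous_on_compose2)
      (auto simp: closure_translation intro!: continuous_intros)
  with assms neg_laplace_eq_delta_translation[of D \<zeta> u c] show ?thesis
    by (auto simp: positive_dirichlet_solution_def frontier_translation)
qed

lemma minimal_dirichlet_solution_translation:
  assumes "minimal_dirichlet_solution D \<zeta> u"
  shows "minimal_dirichlet_solution ((+) c ` D) (c + \<zeta>) (\<lambda>z. u (z - c))"
  unfolding minimal_dirichlet_solution_def
proof (intro conjI allI impI ballI)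
  show "positive_dirichlet_solution ((+) c ` D) (c + \<zeta>) (\<lambda>z. u (z - c))"
    using assms
    by (simp add: minimal_dirichlet_solution_def positive_dirichlet_solution_translation)
next
  fix v z
  assume v: "positive_dirichlet_solution ((+) c ` D) (c + \<zeta>) v"
    and z: "z \<in> (+) c ` D - {c + \<zeta>}"
  \<comment> \<open>Minimality of \<open>u\<close> speaks of competitors on \<open>D\<close> with
    pole \<zeta>, so the competitor \<open>v\<close> is shifted back.\<close>
  from positive_dirichlet_solution_translation[OF v, of "- c"]
  have "positive_dirichlet_solution D \<zeta> (\<lambda>z. v (z + c))"
    by (simp add: image_image)
  moreover from z have "z - c \<in> D - {\<zeta>}"
    by auto
  ultimately have "u (z - c) \<le> v (z - c + c)"
    using assms unfolding minimal_dirichlet_solution_def by blast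
  then show "u (z - c) \<le> v z"
    by simp
qed

text \<open>Translating solutions by \<open>c\<close> and by \<open>- c\<close> shows that both
  definite descriptions range over the same values \<open>g\<close>.\<close>

lemma green_translation: "green ((+) c ` D) (c + z) (c + \<zeta>) = green D z \<zeta>"
proof -
  have "(\<exists>u. minimal_dirichlet_solution ((+) c ` D) (c + \<zeta>) u \<and> g = u (c + z)) \<longleftrightarrow>
      (\<exists>u. minimal_dirichlet_solution D \<zeta> u \<and> g = u z)" for g
  proof
    assume "\<exists>u. minimal_dirichlet_solution ((+) c ` D) (c + \<zeta>) u \<and> g = u (c + z)"
    then obtain u where u: "minimal_dirichlet_solution ((+) c ` D) (c + \<zeta>) u" "g = u (c + z)"
      by blast
    from minimal_dirichlet_solution_translation[OF u(1), of "- c"]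
    have "minimal_dirichlet_solution D \<zeta> (\<lambda>z. u (c + z))"
      by (simp add: image_image add.commute)
    with u(2) show "\<exists>u. minimal_dirichlet_solution D \<zeta> u \<and> g = u z"
      by blast
  next
    assume "\<exists>u. minimal_dirichlet_solution D \<zeta> u \<and> g = u z"
    then obtain u where u: "minimal_dirichlet_solution D \<zeta> u" "g = u z"
      by blast
    from minimal_dirichlet_solution_translation[OF u(1), of c] u(2)
    show "\<exists>u. minimal_dirichlet_solution ((+) c ` D) (c + \<zeta>) u \<and> g = u (c + z)"
      by (intro exI[of _ "\<lambda>z. u (z - c)"]) simp
  qed
  then show ?thesis
    by (simp add: green_def)
qed

text \<open>The punctured neighbourhood filter at \<open>c + z\<close> is the image of the one at
  \<open>z\<close>, so both sides have the same candidate limits, whether or not one exists.\<close>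

lemma Lim_at_translation:
  fixes c z :: "'a::real_normed_vector"
  shows "Lim (at (c + z)) f = Lim (at z) (\<lambda>w. f (c + w))"
proof -
  have "at (c + z) = filtermap (\<lambda>w. w + c) (at z)"
    using filtermap_at_shift[of "- c" z] by (simp add: add.commute)
  then show ?thesis
    by (simp add: Topological_Spaces.Lim_def filterlim_filtermap add.commute)
qed

text \<open>The logarithmic term depends only on the difference of the two points, which translation
  preserves.\<close>

lemma robin_translation: "robin ((+) c ` D) (c + z) = robin D z"
  by (simp add: robin_def Lim_at_translation green_translation)

section \<open>Lattice periodicity and translation of the hull channels\<close>

lemma Basis_subset_int_lattice: "Basis \<subseteq> int_lattice"
  by (auto simp: int_lattice_def inner_Basis)

text \<open>Splits a lattice shift of \<theta> into one seen by \<open>fm\<close> and, with the next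
  lemma, one seen by \<open>fp\<close>; the product basis contains each factor's basis padded by
  0.\<close>

lemma int_lattice_fst: "l \<in> int_lattice \<Longrightarrow> fst l \<in> int_lattice"
  by (force simp: int_lattice_def Basis_prod_def inner_prod_def)

lemma int_lattice_snd: "l \<in> int_lattice \<Longrightarrow> snd l \<in> int_lattice"
  by (force simp: int_lattice_def Basis_prod_def inner_prod_def)

lemma hull_domain_periodic:
  assumes "torus_periodic fm" "torus_periodic fp" "l \<in> int_lattice"
  shows "(\<theta> + (2 * pi) *\<^sub>R l, y) \<in> hull_domain fm fp \<longleftrightarrow> (\<theta>, y) \<in> hull_domain fm fp"
  using assms by (simp add: hull_domain_def torus_periodic_def int_lattice_fst int_lattice_snd)

lemma hull_channel_periodic:
  assumes "torus_periodic fm" "torus_periodic fp" "l \<in> int_lattice"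
  shows "hull_channel fm fp \<omega> (\<theta> + (2 * pi) *\<^sub>R l) = hull_channel fm fp \<omega> \<theta>"
  using assms
  \<comment> \<open>Reassociating makes the lattice term the outermost summand, as in
    \<open>torus_periodic\<close>.\<close>
  by (simp add: hull_channel_def torus_periodic_def int_lattice_fst int_lattice_snd
      flip: add.assoc)

lemma robin_hull_periodic:
  assumes "torus_periodic fm" "torus_periodic fp"
  shows "torus_periodic (\<lambda>\<theta>. robin_hull fm fp \<omega> \<theta> y)"
  using hull_channel_periodic[OF assms] by (simp add: torus_periodic_def robin_hull_def)

text \<open>Moving right by \<open>x\<close> replaces the abscissa \<open>s\<close> by
  \<open>s - x\<close>, and (s - x)\<omega> + (\<theta> + x\<omega>) = s\<omega> + \<theta>.\<close>

lemma hull_channel_translation: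
  "hull_channel fm fp \<omega> \<theta> = (+) (x, 0) ` hull_channel fm fp \<omega> (\<theta> + x *\<^sub>R \<omega>)"
  by (rule set_eqI, unfold mem_translation_iff) (auto simp: hull_channel_def algebra_simps)

lemma robin_hull_channel:
  "robin (hull_channel fm fp \<omega> \<theta>) (x, y) = robin_hull fm fp \<omega> (\<theta> + x *\<^sub>R \<omega>) y"
  \<comment> \<open>The base point \<open>(0, y)\<close> of \<open>robin_hull\<close> is carried to
    \<open>(x, y)\<close>.\<close>
  using robin_translation[of "(x, 0)" "hull_channel fm fp \<omega> (\<theta> + x *\<^sub>R \<omega>)" "(0, y)"]
  by (simp add: robin_hull_def flip: hull_channel_translation)

lemma robin_channel: "robin (channel fm fp \<omega>) (x, y) = robin_hull fm fp \<omega> (x *\<^sub>R \<omega>) y"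
  \<comment> \<open>The original channel is the hull channel at \<theta> = 0.\<close>
  using robin_hull_channel[of fm fp \<omega> 0] by (simp add: hull_channel_def channel_def)

theorem proposition2p2:
  fixes fm :: "real ^ 'm \<Rightarrow> real" and fp :: "real ^ 'n \<Rightarrow> real"
    and \<omega> :: "(real ^ 'm) \<times> (real ^ 'n)" and h0 :: real
  assumes "nonresonant \<omega>"
    and "continuous_on UNIV fm" and "torus_periodic fm"
    and "continuous_on UNIV fp" and "torus_periodic fp"
    and "(INF x::real. fp (x *\<^sub>R snd \<omega>)) - (SUP x::real. fm (x *\<^sub>R fst \<omega>)) = h0"
    and "h0 > 0"
  shows "(\<forall>\<theta> y. (\<theta>, y) \<in> hull_domain fm fp \<longrightarrow>
            (\<forall>b\<in>Basis. (\<theta> + (2 * pi) *\<^sub>R b, y) \<in> hull_domain fm fp \<and>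
               robin_hull fm fp \<omega> (\<theta> + (2 * pi) *\<^sub>R b) y = robin_hull fm fp \<omega> \<theta> y)) \<and>
         (\<forall>\<theta> x y. (x, y) \<in> hull_channel fm fp \<omega> \<theta> \<longrightarrow>
            (\<theta> + x *\<^sub>R \<omega>, y) \<in> hull_domain fm fp \<and>
            robin (hull_channel fm fp \<omega> \<theta>) (x, y) = robin_hull fm fp \<omega> (\<theta> + x *\<^sub>R \<omega>) y) \<and>
         (\<forall>x y. (x, y) \<in> channel fm fp \<omega> \<longrightarrow>
            robin (channel fm fp \<omega>) (x, y) = robin_hull fm fp \<omega> (x *\<^sub>R \<omega>) y) \<and>
         (\<forall>y. (\<forall>x. (x, y) \<in> channel fm fp \<omega>) \<longrightarrow>
            quasi_periodic \<omega> (\<lambda>x. robin (channel fm fp \<omega>) (x, y)))"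
proof (intro conjI allI impI ballI)
  fix \<theta> y and b :: "(real ^ 'm) \<times> (real ^ 'n)"
  assume "(\<theta>, y) \<in> hull_domain fm fp" and "b \<in> Basis"
  moreover from this have "b \<in> int_lattice"
    using Basis_subset_int_lattice by blast
  ultimately show "(\<theta> + (2 * pi) *\<^sub>R b, y) \<in> hull_domain fm fp"
    and "robin_hull fm fp \<omega> (\<theta> + (2 * pi) *\<^sub>R b) y = robin_hull fm fp \<omega> \<theta> y"
    using hull_domain_periodic[OF assms(3,5)] robin_hull_periodic[OF assms(3,5), of \<omega> y]
    unfolding torus_periodic_def by blast+
next
  fix \<theta> x y
  assume "(x, y) \<in> hull_channel fm fp \<omega> \<theta>"
  then show "(\<theta> + x *\<^sub>R \<omega>, y) \<in> hull_domain fm fp"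
    by (simp add: hull_channel_def hull_domain_def add.commute)
  show "robin (hull_channel fm fp \<omega> \<theta>) (x, y) = robin_hull fm fp \<omega> (\<theta> + x *\<^sub>R \<omega>) y"
    by (rule robin_hull_channel)
next
  fix x y
  show "robin (channel fm fp \<omega>) (x, y) = robin_hull fm fp \<omega> (x *\<^sub>R \<omega>) y"
    by (rule robin_channel)
next
  fix y
  show "quasi_periodic \<omega> (\<lambda>x. robin (channel fm fp \<omega>) (x, y))"
    unfolding quasi_periodic_def robin_channel
    \<comment> \<open>The torus function is \<open>robin_hull\<close> at fixed \<open>y\<close>; its
      periodicity also covers those \<theta> for which (\<theta>, y) lies outside
      \<open>hull_domain\<close>.\<close>
    using robin_hull_periodic[OF assms(3,5)] by blast
qed

end
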